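(* Let $\beta\in(0,1)$. Consider the bandit algorithm for tree search (defined in the context) run on the full binary tree of depth $D$ with the Flat-UCB bounds $$B_{i,n_i}=\begin{cases} X_{i,n_i}+\sqrt{\dfrac{\log(\beta_{n_i}^{-1})}{2n_i}} & \text{if } i \text{ is a leaf},\\[2mm] \max_{j\in\mathcal C(i)}B_{j,n_j} & \text{otherwise,}\end{cases}\qquad \beta_n=\frac{\beta}{2^{D+1}n(n+1)}.$$ Let $\mathcal S$ be the set of sub-optimal leaves (leaves $i$ with $\Delta_i>0$) and $\Delta=\min_{i\in\mathcal S}\Delta_i$. Then, with probability at least $1-\beta$, for all $n\ge1$ the cumulative pseudo-regret is bounded by a constant independent of $n$: $$\bar R_n\le 6\sum_{i\in\mathcal S}\frac1{\Delta_i}\log\left(\frac{2^{D+2}}{\Delta_i^2\beta}\right)\le 6\,\frac{2^D}{\Delta}\log\left(\frac{2^{D+2}}{\Delta^2\beta}\right).$$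
   Context: Setting. Consider the full binary tree of depth $D\ge1$ (the root has depth $0$, the $2^D$ leaves have depth $D$, every non-leaf node has two children, and $\mathcal C(i)$ denotes the set of children of $i$). To each leaf $i$ is assigned a random variable $X_i$ with values in $[0,1]$ and unknown law. Successive visits of leaf $i$ yield i.i.d. rewards $x_{i,1},x_{i,2},\dots$ distributed as $X_i$, and rewards of different leaves are independent. The value of a leaf is $\mu_i=\mathbb E X_i$. The value $\mu_i$ of a node $i$ is the maximum of the values of the leaves in the sub-tree rooted at $i$; $\mu^*$ is the value of the root, and $\Delta_i=\mu^*-\mu_i$. $\Delta$ is defined when $\mathcal S\neq\emptyset$. Algorithm. At each round $n=1,2,\dots$ a trajectory is run from the root to a leaf: starting at the root, from the current non-leaf node $i$ move to a child $j\in\mathcal C(i)$ having the highest bound $B_{j,n_j}$ among the children of $i$ (ties broken arbitrarily), where bounds are computed from the data of the previous rounds. On reaching a leaf $I_n$, the next reward sample $x_n$ of that leaf is received, and the number of visits of each node on the trajectory is incremented by one. A leaf that has not yet been visited has bound $+\infty$. Notation. $n_i=n_i(n)$ is the number of trajectories through node $i$ up to the current time $n$; $X_{i,n_i}$ is the empirical mean of the $n_i$ rewards obtained by the trajectories through node $i$. The cumulative pseudo-regret is $\bar R_n=n\mu^*-\sum_{t=1}^n\mu_{I_t}=\sum_{j \text{ leaf}} n_j(n)\Delta_j$. *)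

theory Defs
  imports "HOL-Probability.Probability" "HOL-Library.Sublist"
begin

text \<open>
  Nodes of the full binary tree are addressed by the path leading to them: the root is the empty
  list, and the depth of a node is its length. The node at depth \<open>d\<close> on the trajectory to a leaf
  \<open>l\<close> is \<open>take d l\<close>; a trajectory to \<open>l\<close> passes through \<open>i\<close> iff \<open>prefix i l\<close>.
\<close>

type_synonym node = "bool list"

definition leaves :: "nat \<Rightarrow> node set" where
  "leaves D = {i. length i = D}"

definition children :: "node \<Rightarrow> node set" where
  "children i = {i @ [False], i @ [True]}"

text \<open>Here \<open>\<mu>\<close> gives the values of the leaves.\<close>

definition node_value :: "nat \<Rightarrow> (node \<Rightarrow> real) \<Rightarrow> node \<Rightarrow> real" where
  "node_value D \<mu> i = Max (\<mu> ` {l \<in> leaves D. prefix i l})"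

definition gap :: "nat \<Rightarrow> (node \<Rightarrow> real) \<Rightarrow> node \<Rightarrow> real" where
  "gap D \<mu> i = node_value D \<mu> [] - node_value D \<mu> i"

definition subopt_leaves :: "nat \<Rightarrow> (node \<Rightarrow> real) \<Rightarrow> node set" where
  "subopt_leaves D \<mu> = {i \<in> leaves D. gap D \<mu> i > 0}"

text \<open>Only meaningful if some leaf is sub-optimal.\<close>

definition min_gap :: "nat \<Rightarrow> (node \<Rightarrow> real) \<Rightarrow> real" where
  "min_gap D \<mu> = Min (gap D \<mu> ` subopt_leaves D \<mu>)"

text \<open>
  In the following, \<open>I n\<close> is the leaf reached at round \<open>n \<ge> 1\<close> and \<open>x i k\<close> is the reward of the
  \<open>k\<close>-th visit (\<open>k \<ge> 1\<close>) of leaf \<open>i\<close>, for one realisation of the randomness. The values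
  \<open>I 0\<close> and \<open>x i 0\<close> are never used.
\<close>

definition visits :: "(nat \<Rightarrow> node) \<Rightarrow> nat \<Rightarrow> node \<Rightarrow> nat" where
  "visits I n i = card {t \<in> {1..n}. prefix i (I t)}"

definition reward :: "(node \<Rightarrow> nat \<Rightarrow> real) \<Rightarrow> (nat \<Rightarrow> node) \<Rightarrow> nat \<Rightarrow> real" where
  "reward x I t = x (I t) (visits I t (I t))"

definition empirical_mean ::
  "(node \<Rightarrow> nat \<Rightarrow> real) \<Rightarrow> (nat \<Rightarrow> node) \<Rightarrow> nat \<Rightarrow> node \<Rightarrow> real" where
  "empirical_mean x I n i =
     (\<Sum>t\<in>{t \<in> {1..n}. prefix i (I t)}. reward x I t) / real (visits I n i)"

definition conf_level :: "nat \<Rightarrow> real \<Rightarrow> nat \<Rightarrow> real" where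
  "conf_level D \<beta> n = \<beta> / (2 ^ (D + 1) * real n * (real n + 1))"

text \<open>
  The bound of node \<open>i\<close> computed from the data of rounds \<open>1, \<dots>, n\<close>. Addresses longer than \<open>D\<close> are
  not nodes of the tree; the test is \<open>D \<le> length i\<close> only to make the recursion terminate on them.
\<close>

function flat_ucb ::
  "nat \<Rightarrow> real \<Rightarrow> (node \<Rightarrow> nat \<Rightarrow> real) \<Rightarrow> (nat \<Rightarrow> node) \<Rightarrow> nat \<Rightarrow> node \<Rightarrow> ereal" where
  "flat_ucb D \<beta> x I n i =
     (if D \<le> length i then
        (let m = visits I n i in
         if m = 0 then \<infinity>
         else ereal (empirical_mean x I n i
                       + sqrt (ln (inverse (conf_level D \<beta> m)) / (2 * real m))))
      else Max ((\<lambda>j. flat_ucb D \<beta> x I n j) ` children i))"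
  by pat_completeness auto
termination
  by (relation "Wellfounded.measure (\<lambda>(D, \<beta>, x, I, n, i). D - length i)")
     (auto simp: children_def)

declare flat_ucb.simps [simp del]

text \<open>
  \<open>trajectory D b l\<close>: descending from the root, always moving to a child with the highest bound
  \<open>b\<close>, can end in leaf \<open>l\<close>. It is a relation because ties are broken arbitrarily.
\<close>

definition trajectory :: "nat \<Rightarrow> (node \<Rightarrow> ereal) \<Rightarrow> node \<Rightarrow> bool" where
  "trajectory D b l \<longleftrightarrow> l \<in> leaves D \<and>
     (\<forall>d<D. \<forall>j\<in>children (take d l). b j \<le> b (take (Suc d) l))"

definition tree_search_run :: "nat \<Rightarrow> (nat \<Rightarrow> node \<Rightarrow> ereal) \<Rightarrow> (nat \<Rightarrow> node) \<Rightarrow> bool" where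
  "tree_search_run D B I \<longleftrightarrow> (\<forall>n\<ge>1. trajectory D (B (n - 1)) (I n))"

definition pseudo_regret :: "nat \<Rightarrow> (node \<Rightarrow> real) \<Rightarrow> (nat \<Rightarrow> node) \<Rightarrow> nat \<Rightarrow> real" where
  "pseudo_regret D \<mu> I n = real n * node_value D \<mu> [] - (\<Sum>t=1..n. \<mu> (I t))"

end

theory Submission
  imports Defs
begin

text \<open>
  Compare a sub-optimal leaf \<open>i\<close> with one fixed optimal leaf. The bound of the optimal leaf stays
  above \<open>\<mu>\<^sup>*\<close> at all times with probability at least \<open>1 - \<beta> / 2 ^ (D + 1)\<close>, by a union bound over its
  number of visits. For leaf \<open>i\<close> a single number of visits matters, namely
  \<open>u = \<lfloor>6 L / \<Delta>\<^sub>i\<^sup>2\<rfloor>\<close> with \<open>L = ln (2 ^ (D + 2) / (\<Delta>\<^sub>i\<^sup>2 \<beta>))\<close>: if its bound after \<open>u\<close> visits is below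
  \<open>\<mu>\<^sup>*\<close>, then it is never visited again. By Hoeffding's inequality this fails with probability at most
  \<open>\<beta> / 2 ^ D\<close>. A union bound over all numbers of visits of \<open>i\<close> as well would not be enough: solving
  \<open>\<Delta>\<^sub>i \<le> 2 sqrt (ln (1 / \<beta>\<^sub>m) / (2 m))\<close> for \<open>m\<close> does not give the constant \<open>6\<close>, e.g. for \<open>D = 1\<close>,
  \<open>\<Delta>\<^sub>i = 1\<close> and \<open>\<beta>\<close> close to \<open>1\<close>.
\<close>

section \<open>The tree and its values\<close>

lemma finite_leaves [simp]: "finite (leaves D)"
  and card_leaves: "card (leaves D) = 2 ^ D"
  using finite_lists_length_eq[of "UNIV :: bool set" D] card_lists_length_eq[of "UNIV :: bool set" D]
  by (simp_all add: leaves_def)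

lemma leaves_nonempty: "leaves D \<noteq> {}"
  using card_leaves[of D] by (metis card.empty power_not_zero zero_neq_numeral)

lemma node_value_root: "node_value D \<mu> [] = Max (\<mu> ` leaves D)"
  by (simp add: node_value_def)

lemma node_value_leaf:
  assumes "i \<in> leaves D"
  shows "node_value D \<mu> i = \<mu> i"
proof -
  have "{l \<in> leaves D. prefix i l} = {i}"
    using assms by (auto simp: leaves_def prefix_def)
  then show ?thesis by (simp add: node_value_def)
qed

lemma gap_leaf: "i \<in> leaves D \<Longrightarrow> gap D \<mu> i = node_value D \<mu> [] - \<mu> i"
  by (simp add: gap_def node_value_leaf)

lemma gap_nonneg: "i \<in> leaves D \<Longrightarrow> 0 \<le> gap D \<mu> i"
  by (simp add: gap_leaf node_value_root)

lemma finite_subopt_leaves [simp]: "finite (subopt_leaves D \<mu>)"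
  by (simp add: subopt_leaves_def)

lemma optimal_leaf:
  obtains j where "j \<in> leaves D" "\<mu> j = node_value D \<mu> []"
proof -
  have "Max (\<mu> ` leaves D) \<in> \<mu> ` leaves D"
    by (intro Max_in) (simp_all add: leaves_nonempty)
  then show ?thesis using that by (auto simp: node_value_root)
qed

text \<open>Strictness is the point: some leaf attains the root value, and the place it leaves free
  in the union bound pays for the event of the optimal leaf.\<close>

lemma card_subopt_leaves_less: "card (subopt_leaves D \<mu>) < 2 ^ D"
proof -
  obtain j where "j \<in> leaves D" "\<mu> j = node_value D \<mu> []" by (rule optimal_leaf)
  then have "j \<in> leaves D - subopt_leaves D \<mu>"
    by (simp add: subopt_leaves_def gap_leaf)
  then have "subopt_leaves D \<mu> \<subset> leaves D"
    by (auto simp: subopt_leaves_def)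
  then show ?thesis
    using psubset_card_mono[OF finite_leaves] by (simp add: card_leaves)
qed

text \<open>Bounds of inner nodes are maxima over children, so they never increase on the way down
  to any leaf, while a trajectory always keeps the maximum. Hence descending the tree amounts to
  choosing a leaf with the highest bound among all leaves.\<close>

lemma trajectory_leaf_maximal:
  assumes l: "trajectory D b l" and j: "j \<in> leaves D"
    and b: "\<And>i. length i < D \<Longrightarrow> b i = Max (b ` children i)"
  shows "b j \<le> b l"
proof -
  have fin: "finite (children i)" for i by (simp add: children_def)
  have child: "take (Suc d) k \<in> children (take d k)" if "k \<in> leaves D" "d < D" for k d
    using that by (auto simp: leaves_def children_def take_Suc_conv_app_nth)
  have up: "b (take (Suc d) k) \<le> b (take d k)" if "k \<in> leaves D" "d < D" for k d
    using that fin child[OF that] b[of "take d k"] by (auto simp: leaves_def)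
  have le_root: "b k \<le> b []" if k: "k \<in> leaves D" for k
  proof -
    have "b (take d k) \<le> b []" if "d \<le> D" for d
      using that by (induction d) (auto intro: order_trans[OF up[OF k]])
    from this[of D] show ?thesis using k by (simp add: leaves_def)
  qed
  have lD: "l \<in> leaves D" using l by (simp add: trajectory_def)
  have down: "b (take d l) \<le> b (take (Suc d) l)" if d: "d < D" for d
  proof -
    have "b (take d l) = Max (b ` children (take d l))"
      using d lD by (intro b) (auto simp: leaves_def)
    also have "\<dots> \<le> b (take (Suc d) l)"
      using l d by (intro Max.boundedI) (auto simp: fin trajectory_def children_def)
    finally show ?thesis .
  qed
  have "b [] \<le> b (take d l)" if "d \<le> D" for d
    using that by (induction d) (auto intro: order_trans[OF _ down])
  from this[of D] have "b [] \<le> b l" using lD by (simp add: leaves_def)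
  with le_root[OF j] show ?thesis by (rule order_trans)
qed

section \<open>Visits and regret\<close>

lemma prefix_same_length: "length i = length l \<Longrightarrow> prefix i l \<longleftrightarrow> i = l"
  by (auto simp: prefix_def)

lemma rounds_Suc:
  "{t \<in> {1..Suc n}. P t} = (if P (Suc n) then insert (Suc n) {t \<in> {1..n}. P t} else {t \<in> {1..n}. P t})"
  by (auto simp: le_Suc_eq)

lemma visits_0 [simp]: "visits I 0 i = 0"
  by (simp add: visits_def)

lemma visits_Suc: "visits I (Suc n) i = visits I n i + of_bool (prefix i (I (Suc n)))"
  unfolding visits_def rounds_Suc by simp

text \<open>Passes from rewards indexed by rounds to rewards indexed by visits.
  \<open>reward\<close> counts the current round as a visit, so the first visit reads
  \<open>x i 1\<close>.\<close>

lemma sum_reward_leaf: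
  assumes "i \<in> leaves D" "\<And>t. t \<ge> 1 \<Longrightarrow> I t \<in> leaves D"
  shows "(\<Sum>t\<in>{t \<in> {1..n}. prefix i (I t)}. reward x I t) = (\<Sum>k=1..visits I n i. x i k)"
proof (induction n)
  case (Suc n)
  have "prefix i (I (Suc n)) \<longleftrightarrow> i = I (Suc n)"
    using assms by (intro prefix_same_length) (simp add: leaves_def)
  then show ?case
    using Suc.IH unfolding rounds_Suc by (auto simp: visits_Suc reward_def)
qed simp

lemma pseudo_regret_eq:
  assumes "\<And>t. t \<ge> 1 \<Longrightarrow> I t \<in> leaves D"
  shows "pseudo_regret D \<mu> I n = (\<Sum>i\<in>subopt_leaves D \<mu>. real (visits I n i) * gap D \<mu> i)"
proof -
  have "pseudo_regret D \<mu> I n = (\<Sum>i\<in>leaves D. real (visits I n i) * gap D \<mu> i)"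
  proof (induction n)
    case (Suc n)
    have I: "I (Suc n) \<in> leaves D" using assms by simp
    have "(\<Sum>i\<in>leaves D. real (visits I (Suc n) i) * gap D \<mu> i) =
        (\<Sum>i\<in>leaves D. real (visits I n i) * gap D \<mu> i + (if i = I (Suc n) then gap D \<mu> i else 0))"
    proof (rule sum.cong[OF refl])
      fix i assume "i \<in> leaves D"
      then have "prefix i (I (Suc n)) \<longleftrightarrow> i = I (Suc n)"
        using I by (intro prefix_same_length) (simp add: leaves_def)
      then show "real (visits I (Suc n) i) * gap D \<mu> i =
          real (visits I n i) * gap D \<mu> i + (if i = I (Suc n) then gap D \<mu> i else 0)"
        by (simp add: visits_Suc algebra_simps)
    qed
    also have "\<dots> = pseudo_regret D \<mu> I n + gap D \<mu> (I (Suc n))"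
      using I by (simp add: sum.distrib Suc.IH)
    also have "\<dots> = pseudo_regret D \<mu> I (Suc n)"
      using I by (simp add: pseudo_regret_def gap_leaf algebra_simps)
    finally show ?case by simp
  qed (simp add: pseudo_regret_def)
  \<comment> \<open>Leaves outside \<open>subopt_leaves\<close> have gap zero, since gaps of leaves
    are nonnegative.\<close>
  also have "\<dots> = (\<Sum>i\<in>subopt_leaves D \<mu>. real (visits I n i) * gap D \<mu> i)"
  proof (intro sum.mono_neutral_right ballI)
    fix i assume "i \<in> leaves D - subopt_leaves D \<mu>"
    then have "gap D \<mu> i = 0" using gap_nonneg[of i D \<mu>] by (simp add: subopt_leaves_def)
    then show "real (visits I n i) * gap D \<mu> i = 0" by simp
  qed (auto simp: subopt_leaves_def)
  finally show ?thesis .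
qed

section \<open>Flat-UCB bounds\<close>

text \<open>The term that \<open>flat_ucb\<close> adds to the empirical mean of a leaf after
  \<open>m\<close> visits.\<close>

definition conf_width :: "nat \<Rightarrow> real \<Rightarrow> nat \<Rightarrow> real" where
  "conf_width D \<beta> m = sqrt (ln (inverse (conf_level D \<beta> m)) / (2 * real m))"

lemma inverse_conf_level:
  "inverse (conf_level D \<beta> m) = 2 ^ (D + 1) / \<beta> * real m * (real m + 1)"
  by (simp add: conf_level_def field_simps)

text \<open>The bound depends on the history only through the number of visits \<open>m\<close>. So
  it suffices to control averages of a fixed number of rewards, although the visit counts are
  random.\<close>

lemma flat_ucb_leaf:
  assumes "i \<in> leaves D" "\<And>t. t \<ge> 1 \<Longrightarrow> I t \<in> leaves D"
  shows "flat_ucb D \<beta> x I n i =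
    (let m = visits I n i in
     if m = 0 then \<infinity> else ereal ((\<Sum>k=1..m. x i k) / real m + conf_width D \<beta> m))"
proof -
  have "D \<le> length i" using assms(1) by (simp add: leaves_def)
  then show ?thesis
    using sum_reward_leaf[OF assms, where n = n and x = x]
    by (subst flat_ucb.simps) (simp add: Let_def conf_width_def empirical_mean_def)
qed

text \<open>The deterministic core: a leaf whose bound after \<open>u\<close> visits lies below
  \<open>v\<close> loses against a leaf \<open>j\<close> whose bound always exceeds
  \<open>v\<close>.\<close>

lemma visits_le:
  assumes run: "tree_search_run D (flat_ucb D \<beta> x I) I"
    and i: "i \<in> leaves D" and j: "j \<in> leaves D" and "u \<ge> 1"
    and opt: "\<And>k. k \<ge> 1 \<Longrightarrow> v < (\<Sum>k=1..k. x j k) / real k + conf_width D \<beta> k"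
    and sub: "(\<Sum>k=1..u. x i k) / real u + conf_width D \<beta> u < v"
  shows "visits I n i \<le> u"
proof (induction n)
  case (Suc n)
  have traj: "trajectory D (flat_ucb D \<beta> x I n) (I (Suc n))"
    using run unfolding tree_search_run_def by (metis diff_Suc_1 le_add1 plus_1_eq_Suc)
  have leaf: "I t \<in> leaves D" if "t \<ge> 1" for t
    using run that by (auto simp: tree_search_run_def trajectory_def)
  \<comment> \<open>The count grows by at most one per round, so it can exceed \<open>u\<close> only
    through a visit made when it equals \<open>u\<close>.\<close>
  have "\<not> (visits I n i = u \<and> prefix i (I (Suc n)))"
  proof
    assume "visits I n i = u \<and> prefix i (I (Suc n))"
    then have u: "visits I n i = u" and "prefix i (I (Suc n))" by auto
    moreover have "length i = length (I (Suc n))"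
      using i leaf[of "Suc n"] by (simp add: leaves_def)
    ultimately have I: "I (Suc n) = i" by (simp add: prefix_same_length)
    have "flat_ucb D \<beta> x I n j \<le> flat_ucb D \<beta> x I n i"
      using traj unfolding I
      by (rule trajectory_leaf_maximal[OF _ j]) (subst flat_ucb.simps, simp)
    also have "\<dots> = ereal ((\<Sum>k=1..u. x i k) / real u + conf_width D \<beta> u)"
      using u \<open>u \<ge> 1\<close> by (simp add: flat_ucb_leaf[OF i leaf])
    also have "\<dots> < ereal v" using sub by simp
    finally have "flat_ucb D \<beta> x I n j < ereal v" .
    \<comment> \<open>If \<open>j\<close> is still unvisited, its bound is infinite; otherwise
      \<open>opt\<close> applies.\<close>
    moreover have "ereal v < flat_ucb D \<beta> x I n j"
      using opt[of "visits I n j"] by (simp add: flat_ucb_leaf[OF j leaf] Let_def)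
    ultimately show False by simp
  qed
  then show ?case using Suc.IH by (auto simp: visits_Suc)
qed simp

section \<open>Numerical estimates\<close>

text \<open>Telescoping with \<open>1 / (m * (m + 1)) = 1 / m - 1 / (m + 1)\<close>. The shift by
  \<open>Suc\<close> starts the series at one visit.\<close>

lemma sum_conf_level:
  "(\<lambda>k. conf_level D \<beta> (Suc k)) sums (\<beta> / 2 ^ (D + 1))"
proof -
  have "(\<lambda>k. 1 / (real k + 1)) \<longlonglongrightarrow> 0"
    using LIMSEQ_inverse_real_of_nat by (simp add: inverse_eq_divide add.commute)
  from sums_mult[OF telescope_sums'[OF this], of "\<beta> / 2 ^ (D + 1)"]
  have "(\<lambda>k. \<beta> / 2 ^ (D + 1) * (1 / (real k + 1) - 1 / (real (Suc k) + 1))) sums (\<beta> / 2 ^ (D + 1))"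
    by simp
  also have "(\<lambda>k. \<beta> / 2 ^ (D + 1) * (1 / (real k + 1) - 1 / (real (Suc k) + 1))) =
      (\<lambda>k. conf_level D \<beta> (Suc k))"
  proof
    fix k
    have "1 / (real k + 1) - 1 / (real (Suc k) + 1) = 1 / ((real k + 1) * (real (Suc k) + 1))"
      by (simp add: divide_simps)
    then show "\<beta> / 2 ^ (D + 1) * (1 / (real k + 1) - 1 / (real (Suc k) + 1)) = conf_level D \<beta> (Suc k)"
      by (simp add: conf_level_def add_ac mult_ac)
  qed
  finally show ?thesis .
qed

lemma conf_level_bounds:
  assumes "0 < \<beta>" "\<beta> < 1" "m \<ge> 1"
  shows "0 < conf_level D \<beta> m" "conf_level D \<beta> m < 1"
proof -
  show "0 < conf_level D \<beta> m" using assms by (simp add: conf_level_def)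
  have "1 \<le> (2::real) ^ (D + 1)" by (rule one_le_power) simp
  then have "1 \<le> 2 ^ (D + 1) * real m * (real m + 1)"
    using assms by (intro mult_ge1_I) auto
  then have "\<beta> < 2 ^ (D + 1) * real m * (real m + 1)" using assms by linarith
  then show "conf_level D \<beta> m < 1" using assms by (simp add: conf_level_def)
qed

text \<open>The width is chosen so that Hoeffding's bound for \<open>m\<close> rewards in [0,1] at
  this deviation equals the confidence level. The square root can be undone because a level below 1
  has a negative logarithm.\<close>

lemma exp_conf_width:
  assumes "0 < \<beta>" "\<beta> < 1" "m \<ge> 1"
  shows "exp (- (2 * real m * (conf_width D \<beta> m)\<^sup>2)) = conf_level D \<beta> m"
proof -
  note c = conf_level_bounds[OF assms, of D]
  have "(conf_width D \<beta> m)\<^sup>2 = - ln (conf_level D \<beta> m) / (2 * real m)"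
    using c ln_less_zero[OF c]
    by (simp add: conf_width_def ln_inverse divide_nonpos_nonneg del: inverse_eq_divide)
  then show ?thesis using c assms by simp
qed

lemma conf_width_nonneg:
  assumes "0 < \<beta>" "\<beta> < 1" "m \<ge> 1"
  shows "0 \<le> conf_width D \<beta> m"
  using ln_less_zero[OF conf_level_bounds[OF assms]] conf_level_bounds[OF assms, of D]
  by (simp add: conf_width_def ln_inverse divide_simps mult_le_0_iff)

text \<open>Used with \<open>a = 2 ^ (D + 1) / \<beta>\<close> and \<open>s\<close> the squared gap,
  so that \<open>L\<close> is the logarithm in the regret bound. The first logarithm on the left
  stems from the desired failure probability \<open>2 / a\<close>, the second from the confidence
  width at \<open>u\<close> visits.\<close>

lemma conf_threshold_bound:
  fixes a s :: real
  assumes a: "a \<ge> 4" and s: "0 < s" "s \<le> 1"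
  defines "L \<equiv> ln (2 * a / s)"
  defines "u \<equiv> nat \<lfloor>6 * L / s\<rfloor>"
  shows "u \<ge> 1" and "ln (a / 2) + ln (a * real u * (real u + 1)) \<le> real u * s"
proof -
  \<comment> \<open>The size of \<open>a\<close> gives
    \<open>L \<ge> ln 8 \<ge> ln 3 \<ge> 1\<close>, which later absorbs the logarithms of the
    constants.\<close>
  have "8 * s \<le> 2 * a" using a s by linarith
  then have "8 \<le> 2 * a / s" using s by (simp add: field_simps)
  then have "ln 8 \<le> L" unfolding L_def by simp
  moreover have "ln (3::real) \<le> ln 8" "1 \<le> ln (3::real)"
    using exp_le by (simp_all add: ln_ge_iff)
  ultimately have L3: "ln 3 \<le> L" and L1: "1 \<le> L" by linarith+
  have "6 * s \<le> 6 * L" using L1 s by linarith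
  then have big: "6 \<le> 6 * L / s" using s by (simp add: field_simps)
  have u_le: "real u \<le> 6 * L / s" and u_gt: "6 * L / s < real u + 1"
    unfolding u_def using big by linarith+
  show u1: "u \<ge> 1" using big u_gt by linarith
  \<comment> \<open>Rounding down to an integer number of visits costs at most
    \<open>s\<close>.\<close>
  have us: "6 * L - s < real u * s" using u_gt s by (simp add: field_simps)
  have "ln (real u) \<le> ln (6 * L / s)" using u_le u1 by (subst ln_le_cancel_iff) linarith+
  also have "\<dots> = ln 2 + ln 3 + ln L - ln s"
    using L1 s ln_mult[of 2 "3::real"] by (simp add: ln_div ln_mult)
  finally have lnu: "ln (real u) \<le> ln 2 + ln 3 + ln L - ln s" .
  \<comment> \<open>The \<open>ln 2\<close> lost here cancels against the one in
    \<open>ln (a / 2)\<close>.\<close>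
  have "ln (real u + 1) \<le> ln (2 * real u)" using u1 by (subst ln_le_cancel_iff) linarith+
  also have "\<dots> = ln 2 + ln (real u)" using u1 by (simp add: ln_mult)
  finally have lnu1: "ln (real u + 1) \<le> ln 2 + ln (real u)" .
  have L: "L = ln 2 + ln a - ln s" using a s by (simp add: L_def ln_div ln_mult)
  \<comment> \<open>Origin of the constant 6: the left side is at most
    \<open>2 * L + 2 * ln 3 + 2 * ln L\<close>, where the last two terms are at most
    \<open>2 * L\<close> and \<open>2 * L - 2\<close>. The spare 2 covers the rounding loss
    \<open>s\<close>.\<close>
  have "ln L \<le> L - 1" using L1 by (intro ln_le_minus_one) simp
  moreover have "2 * ln a + 2 * (ln 2 + ln 3 + ln L - ln s) = 2 * L + 2 * ln 3 + 2 * ln L"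
    using L by simp
  ultimately have "2 * ln a + 2 * (ln 2 + ln 3 + ln L - ln s) \<le> 6 * L - s"
    using L3 s(2) by argo
  moreover have "ln (a / 2) = ln a - ln 2" using a by (simp add: ln_div)
  moreover have "ln (a * real u * (real u + 1)) = ln a + ln (real u) + ln (real u + 1)"
    using a u1 by (simp add: ln_mult)
  ultimately show "ln (a / 2) + ln (a * real u * (real u + 1)) \<le> real u * s"
    using lnu lnu1 us by argo
qed

text \<open>For the bound of a leaf with gap \<open>d\<close> to reach the optimal value after
  \<open>u\<close> visits, its empirical mean must exceed its value by at least
  \<open>d - conf_width D \<beta> u\<close>. The exponential is Hoeffding's bound for that
  event.\<close>

lemma exp_gap_minus_conf_width:
  fixes d :: real
  assumes D: "D \<ge> 1" and \<beta>: "0 < \<beta>" "\<beta> < 1" and d: "0 < d" "d \<le> 1"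
  defines "u \<equiv> nat \<lfloor>6 * ln (2 ^ (D + 2) / (d\<^sup>2 * \<beta>)) / d\<^sup>2\<rfloor>"
  shows "u \<ge> 1" and "conf_width D \<beta> u \<le> d"
    and "exp (- (2 * real u * (d - conf_width D \<beta> u)\<^sup>2)) \<le> \<beta> / 2 ^ D"
proof -
  define a :: real where "a = 2 ^ (D + 1) / \<beta>"
  have "(2::real) ^ 2 \<le> 2 ^ (D + 1)" using D by (intro power_increasing) auto
  then have "4 * \<beta> \<le> 2 ^ (D + 1)" using \<beta> by simp
  then have a: "a \<ge> 4" using \<beta> by (simp add: a_def field_simps)
  have s: "0 < d\<^sup>2" "d\<^sup>2 \<le> 1" using d by (auto simp: power_le_one)
  have "2 * a / d\<^sup>2 = 2 ^ (D + 2) / (d\<^sup>2 * \<beta>)" by (simp add: a_def field_simps)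
  then have u: "u = nat \<lfloor>6 * ln (2 * a / d\<^sup>2) / d\<^sup>2\<rfloor>" by (simp add: u_def)
  show u1: "u \<ge> 1" using conf_threshold_bound(1)[OF a s] u by simp
  \<comment> \<open>After scaling by \<open>sqrt u\<close>, \<open>q\<close> is the confidence width
    and \<open>p\<close> the deviation at which Hoeffding's bound equals
    \<open>2 / a = \<beta> / 2 ^ D\<close>. The goal becomes
    \<open>p + q \<le> sqrt u * d\<close>.\<close>
  define q where "q = sqrt (ln (a * real u * (real u + 1)) / 2)"
  define p where "p = sqrt (ln (a / 2) / 2)"
  have "1 \<le> inverse (conf_level D \<beta> u)"
    using conf_level_bounds[OF \<beta> u1, of D] by (simp add: one_le_inverse_iff)
  then have lnq: "0 \<le> ln (a * real u * (real u + 1))"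
    unfolding inverse_conf_level a_def by simp
  have lnp: "0 \<le> ln (a / 2)" using a by simp
  have q: "0 \<le> q" "q\<^sup>2 = ln (a * real u * (real u + 1)) / 2" using lnq by (simp_all add: q_def)
  have p: "0 \<le> p" "p\<^sup>2 = ln (a / 2) / 2" using lnp by (simp_all add: p_def)
  have w: "sqrt u * conf_width D \<beta> u = q"
    using u1 unfolding q_def conf_width_def inverse_conf_level a_def
    by (simp add: real_sqrt_divide real_sqrt_mult)
  \<comment> \<open>The right side is exactly the sum of the two logarithms in
    \<open>conf_threshold_bound\<close>.\<close>
  have "(p + q)\<^sup>2 \<le> 2 * p\<^sup>2 + 2 * q\<^sup>2"
    using zero_le_power2[of "p - q"] by (simp add: power2_sum power2_diff)
  also have "\<dots> \<le> (sqrt u * d)\<^sup>2"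
    using conf_threshold_bound(2)[OF a s] by (simp add: u p q power_mult_distrib)
  finally have pq: "p + q \<le> sqrt u * d" using d by (rule_tac power2_le_imp_le) auto
  then have "p \<le> sqrt u * (d - conf_width D \<beta> u)" using w by (simp add: algebra_simps)
  moreover from this have "0 \<le> sqrt u * (d - conf_width D \<beta> u)" using p by linarith
  ultimately have "p\<^sup>2 \<le> (sqrt u * (d - conf_width D \<beta> u))\<^sup>2" and "conf_width D \<beta> u \<le> d"
    using p u1 by (auto simp: zero_le_mult_iff intro: power_mono)
  then show "conf_width D \<beta> u \<le> d" by simp
  have "ln (a / 2) \<le> 2 * real u * (d - conf_width D \<beta> u)\<^sup>2"
    using \<open>p\<^sup>2 \<le> _\<close> by (simp add: p power_mult_distrib)
  then have "exp (- (2 * real u * (d - conf_width D \<beta> u)\<^sup>2)) \<le> exp (- ln (a / 2))" by simp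
  also have "\<dots> = \<beta> / 2 ^ D" using a by (simp add: exp_minus) (simp add: a_def)
  finally show "exp (- (2 * real u * (d - conf_width D \<beta> u)\<^sup>2)) \<le> \<beta> / 2 ^ D" .
qed

text \<open>Each summand decreases in the gap: both factors do, and the logarithm is nonnegative
  because gaps are at most 1. So every summand is at most the one at the minimal gap, and there are
  fewer than \<open>2 ^ D\<close> of them.\<close>

lemma sum_subopt_leaves_le:
  assumes "subopt_leaves D \<mu> \<noteq> {}" and "0 < \<beta>" "\<beta> < 1"
    and gap_le: "\<And>i. i \<in> leaves D \<Longrightarrow> gap D \<mu> i \<le> 1"
  shows "6 * (\<Sum>i\<in>subopt_leaves D \<mu>. 1 / gap D \<mu> i * ln (2 ^ (D + 2) / ((gap D \<mu> i)\<^sup>2 * \<beta>)))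
    \<le> 6 * (2 ^ D / min_gap D \<mu>) * ln (2 ^ (D + 2) / ((min_gap D \<mu>)\<^sup>2 * \<beta>))"
proof -
  define S where "S = subopt_leaves D \<mu>"
  define d where "d = min_gap D \<mu>"
  define L where "L = (\<lambda>d. ln (2 ^ (D + 2) / (d\<^sup>2 * \<beta>)))"
  have S: "finite S" "S \<noteq> {}" using assms by (simp_all add: S_def)
  have "d \<in> gap D \<mu> ` S" using S unfolding d_def min_gap_def S_def[symmetric] by (intro Min_in) auto
  then have d: "0 < d" "d \<le> 1" using gap_le by (auto simp: S_def subopt_leaves_def)
  have L_nonneg: "0 \<le> L e" if "0 < e" "e \<le> 1" for e
  proof -
    have "e\<^sup>2 * \<beta> \<le> 1" using that assms by (intro mult_le_one power_le_one) auto
    also have "1 \<le> (2::real) ^ (D + 2)" by (rule one_le_power) simp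
    finally show ?thesis using that assms by (simp add: L_def)
  qed
  have "1 / gap D \<mu> i * L (gap D \<mu> i) \<le> 1 / d * L d" if i: "i \<in> S" for i
  proof -
    have g: "0 < gap D \<mu> i" "gap D \<mu> i \<le> 1" 
      using i gap_le by (auto simp: S_def subopt_leaves_def)
    have dg: "d \<le> gap D \<mu> i"
      using S i unfolding d_def min_gap_def S_def[symmetric] by simp
    have "L (gap D \<mu> i) \<le> L d"
      unfolding L_def using d dg g assms
      by (subst ln_le_cancel_iff) (auto intro!: divide_left_mono mult_right_mono power_mono mult_pos_pos)
    then show ?thesis
      using L_nonneg[OF g] d dg g by (intro mult_mono divide_left_mono) auto
  qed
  then have "(\<Sum>i\<in>S. 1 / gap D \<mu> i * L (gap D \<mu> i)) \<le> real (card S) * (1 / d * L d)"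
    by (rule sum_bounded_above)
  also have "\<dots> \<le> 2 ^ D * (1 / d * L d)"
  proof (rule mult_right_mono)
    show "real (card S) \<le> 2 ^ D"
      using card_subopt_leaves_less[of D \<mu>] of_nat_mono[of "card S" "2 ^ D"] by (simp add: S_def)
    show "0 \<le> 1 / d * L d" using L_nonneg[OF d] d by simp
  qed
  finally show ?thesis unfolding S_def d_def L_def by (simp add: mult_ac)
qed

section \<open>Concentration\<close>

context prob_space
begin

context
  fixes x :: "'b \<Rightarrow> nat \<Rightarrow> 'a \<Rightarrow> real" and A :: "'b set" and Y :: "'a \<Rightarrow> real" and i :: 'b and m :: nat
  assumes indep: "indep_vars (\<lambda>_. borel) (\<lambda>(i, k). x i k) (A \<times> {1..})"
    and i: "i \<in> A"
    and distr: "\<And>k. k \<ge> 1 \<Longrightarrow> distr M borel (x i k) = distr M borel Y"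
    and Y: "Y \<in> borel_measurable M" "AE \<omega> in M. Y \<omega> \<in> {0..1}"
begin

lemma arm_measurable: "k \<ge> 1 \<Longrightarrow> x i k \<in> borel_measurable M"
  using indep i unfolding indep_vars_def by fastforce

lemma arm_mean_measurable [measurable]: "(\<lambda>\<omega>. (\<Sum>k=1..m. x i k \<omega>) / real m) \<in> borel_measurable M"
  using arm_measurable by (intro borel_measurable_divide borel_measurable_sum) auto

lemma arm_mean_concentration:
  assumes "m \<ge> 1" "0 \<le> e"
  shows "prob {\<omega> \<in> space M. expectation Y + e \<le> (\<Sum>k=1..m. x i k \<omega>) / real m} \<le> exp (- (2 * real m * e\<^sup>2))"
    and "prob {\<omega> \<in> space M. (\<Sum>k=1..m. x i k \<omega>) / real m \<le> expectation Y - e} \<le> exp (- (2 * real m * e\<^sup>2))"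
proof -
  \<comment> \<open>Hoeffding's inequality for the first \<open>m\<close> rewards of leaf
    \<open>i\<close>, seen as one row of the independent array; \<open>Y\<close> represents their
    common law.\<close>
  interpret Hoeffding_ineq_iid M "{i} \<times> {1..m}" "\<lambda>(i, k). x i k" Y 0 1 "expectation Y"
  proof unfold_locales
    show "indep_vars (\<lambda>_. borel) (\<lambda>(i, k). x i k) ({i} \<times> {1..m})"
      using indep by (rule indep_vars_subset) (use i in auto)
  qed (use Y distr in auto)
  have "(\<Sum>p\<in>{i} \<times> {1..m}. (case p of (i, k) \<Rightarrow> x i k) \<omega>) = (\<Sum>k=1..m. x i k \<omega>)" for \<omega>
    using sum.cartesian_product[of "\<lambda>i k. x i k \<omega>" "{1..m}" "{i}"] by (simp add: case_prod_unfold)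
  moreover have "{i} \<times> {1..m} \<noteq> {}" using assms by auto
  ultimately show
    "prob {\<omega> \<in> space M. expectation Y + e \<le> (\<Sum>k=1..m. x i k \<omega>) / real m} \<le> exp (- (2 * real m * e\<^sup>2))"
    "prob {\<omega> \<in> space M. (\<Sum>k=1..m. x i k \<omega>) / real m \<le> expectation Y - e} \<le> exp (- (2 * real m * e\<^sup>2))"
    using Hoeffding_ineq_ge'[OF assms(2)] Hoeffding_ineq_le'[OF assms(2)]
    by (simp_all add: card_cartesian_product)
qed

end

end

section \<open>Regret bound from a union bound over the bad events\<close>

theorem theorem2:
  fixes M :: "'w measure" and D :: nat and \<beta> :: real
    and X :: "node \<Rightarrow> 'w \<Rightarrow> real"
    and x :: "node \<Rightarrow> nat \<Rightarrow> 'w \<Rightarrow> real"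
    and I :: "nat \<Rightarrow> 'w \<Rightarrow> node"
    and \<mu> :: "node \<Rightarrow> real"
  assumes "prob_space M" and "D \<ge> 1" and "0 < \<beta>" and "\<beta> < 1"
    and "\<And>i. i \<in> leaves D \<Longrightarrow> X i \<in> borel_measurable M"
    and "\<And>i. i \<in> leaves D \<Longrightarrow> AE \<omega> in M. X i \<omega> \<in> {0..1}"
    and "\<And>i k. i \<in> leaves D \<Longrightarrow> k \<ge> 1 \<Longrightarrow> distr M borel (x i k) = distr M borel (X i)"
    and "prob_space.indep_vars M (\<lambda>_. borel) (\<lambda>(i, k). x i k) (leaves D \<times> {1..})"
    and "\<And>i. i \<in> leaves D \<Longrightarrow> \<mu> i = prob_space.expectation M (X i)"
    and "\<And>\<omega>. \<omega> \<in> space M \<Longrightarrow>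
           tree_search_run D (flat_ucb D \<beta> (\<lambda>i k. x i k \<omega>) (\<lambda>n. I n \<omega>)) (\<lambda>n. I n \<omega>)"
  shows "(\<exists>E \<in> sets M. measure M E \<ge> 1 - \<beta> \<and>
            (\<forall>\<omega>\<in>E. \<forall>n\<ge>1. pseudo_regret D \<mu> (\<lambda>n. I n \<omega>) n
               \<le> 6 * (\<Sum>i\<in>subopt_leaves D \<mu>.
                        1 / gap D \<mu> i * ln (2 ^ (D + 2) / ((gap D \<mu> i)\<^sup>2 * \<beta>)))))
       \<and> (subopt_leaves D \<mu> \<noteq> {} \<longrightarrow>
            6 * (\<Sum>i\<in>subopt_leaves D \<mu>.
                   1 / gap D \<mu> i * ln (2 ^ (D + 2) / ((gap D \<mu> i)\<^sup>2 * \<beta>)))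
            \<le> 6 * (2 ^ D / min_gap D \<mu>) * ln (2 ^ (D + 2) / ((min_gap D \<mu>)\<^sup>2 * \<beta>)))"
proof -
  interpret prob_space M by fact
  note D = assms(2) and \<beta> = assms(3,4) and X_meas = assms(5) and X_bounds = assms(6)
    and distr = assms(7) and indep = assms(8) and \<mu> = assms(9) and run = assms(10)
  let ?mean = "\<lambda>i m \<omega>. (\<Sum>k=1..m. x i k \<omega>) / real m"
  have \<mu>_bounds: "0 \<le> \<mu> i" "\<mu> i \<le> 1" if i: "i \<in> leaves D" for i
  proof -
    have ae: "AE \<omega> in M. 0 \<le> X i \<omega>" "AE \<omega> in M. X i \<omega> \<le> 1"
      using X_bounds[OF i] by (auto elim: eventually_mono)
    have int: "integrable M (X i)"
      using X_bounds[OF i] by (intro integrable_const_bound[where B = 1] X_meas[OF i]) (auto elim: eventually_mono)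
    show "0 \<le> \<mu> i" unfolding \<mu>[OF i] by (rule integral_nonneg_AE) fact
    show "\<mu> i \<le> 1" unfolding \<mu>[OF i] using int ae by (intro integral_le_const) auto
  qed
  define S where "S = subopt_leaves D \<mu>"
  define v where "v = node_value D \<mu> []"
  define u where "u = (\<lambda>i. nat \<lfloor>6 * ln (2 ^ (D + 2) / ((gap D \<mu> i)\<^sup>2 * \<beta>)) / (gap D \<mu> i)\<^sup>2\<rfloor>)"
  \<comment> \<open>One optimal leaf competes with all sub-optimal leaves, so its failure
    probability is paid only once.\<close>
  obtain j where j: "j \<in> leaves D" "\<mu> j = v"
    unfolding v_def by (rule optimal_leaf)
  have gap_le: "gap D \<mu> i \<le> 1" if "i \<in> leaves D" for i
    using that \<mu>_bounds[OF that] \<mu>_bounds[OF j(1)] j(2) by (simp add: gap_leaf v_def)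
  have S: "i \<in> leaves D" "0 < gap D \<mu> i" "gap D \<mu> i \<le> 1" "\<mu> i = v - gap D \<mu> i" if "i \<in> S" for i
    using that gap_le by (auto simp: S_def subopt_leaves_def gap_leaf v_def)
  have threshold: "u i \<ge> 1" "conf_width D \<beta> (u i) \<le> gap D \<mu> i"
    "exp (- (2 * real (u i) * (gap D \<mu> i - conf_width D \<beta> (u i))\<^sup>2)) \<le> \<beta> / 2 ^ D" if "i \<in> S" for i
    using exp_gap_minus_conf_width[OF D \<beta> S(2,3)[OF that]] by (simp_all only: u_def)
  note mean_meas [measurable] = arm_mean_measurable[OF indep _ distr X_meas X_bounds]

  \<comment> \<open>\<open>F k\<close>: the bound of \<open>j\<close> after \<open>Suc k\<close>
    visits does not exceed \<open>v\<close>. \<open>G i\<close>: the bound of leaf \<open>i\<close>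
    after \<open>u i\<close> visits is at least \<open>v\<close>. Both speak of rewards only, not of
    the choices \<open>I\<close>, so they are measurable.\<close>
  define F where "F = (\<lambda>k. {\<omega> \<in> space M. ?mean j (Suc k) \<omega> \<le> v - conf_width D \<beta> (Suc k)})"
  define G where "G = (\<lambda>i. {\<omega> \<in> space M. v - conf_width D \<beta> (u i) \<le> ?mean i (u i) \<omega>})"
  have F_sets: "F k \<in> sets M" for k using j(1) unfolding F_def by measurable
  have G_sets: "G i \<in> sets M" if "i \<in> S" for i using S(1)[OF that] unfolding G_def by measurable

  have F_prob: "prob (F k) \<le> conf_level D \<beta> (Suc k)" for k
  proof -
    have "prob (F k) \<le> exp (- (2 * real (Suc k) * (conf_width D \<beta> (Suc k))\<^sup>2))"
      unfolding F_def j(2)[symmetric] \<mu>[OF j(1)]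
      by (rule arm_mean_concentration(2)[OF indep j(1) distr[OF j(1)] X_meas[OF j(1)] X_bounds[OF j(1)]])
         (use conf_width_nonneg[OF \<beta>] in auto)
    then show ?thesis using exp_conf_width[OF \<beta>, of "Suc k"] by simp
  qed
  have G_prob: "prob (G i) \<le> \<beta> / 2 ^ D" if i: "i \<in> S" for i
  proof -
    let ?e = "gap D \<mu> i - conf_width D \<beta> (u i)"
    have "v - conf_width D \<beta> (u i) = expectation (X i) + ?e"
      using S(4)[OF i] \<mu>[OF S(1)[OF i]] by simp
    then have "prob (G i) \<le> exp (- (2 * real (u i) * ?e\<^sup>2))"
      unfolding G_def
      using arm_mean_concentration(1)[OF indep S(1)[OF i] distr[OF S(1)[OF i]] X_meas[OF S(1)[OF i]]
          X_bounds[OF S(1)[OF i]] threshold(1)[OF i], of ?e] threshold(2)[OF i]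
      by (simp only: diff_ge_0_iff_ge)
    also have "\<dots> \<le> \<beta> / 2 ^ D" by (rule threshold(3)[OF i])
    finally show ?thesis .
  qed

  have summable: "summable (\<lambda>k. prob (F k))"
    by (rule summable_comparison_test'[OF sums_summable[OF sum_conf_level[of D \<beta>]]]) (use F_prob in simp)
  have "prob (\<Union>k. F k) \<le> (\<Sum>k. prob (F k))"
    using F_sets summable by (intro finite_measure_subadditive_countably) auto
  also have "\<dots> \<le> \<beta> / 2 ^ (D + 1)"
    using sum_conf_level[of D \<beta>] F_prob summable by (metis suminf_le sums_iff)
  \<comment> \<open>Weakened so that \<open>j\<close> and each sub-optimal leaf have the same share
    \<open>\<beta> / 2 ^ D\<close>; there are at most \<open>2 ^ D\<close> shares.\<close>
  also have "\<dots> \<le> \<beta> / 2 ^ D" using \<beta> by (simp add: field_simps)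
  finally have F: "prob (\<Union>k. F k) \<le> \<beta> / 2 ^ D" .
  have "prob (\<Union>i\<in>S. G i) \<le> (\<Sum>i\<in>S. prob (G i))"
    using G_sets by (intro finite_measure_subadditive_finite) (auto simp: S_def)
  also have "\<dots> \<le> real (card S) * (\<beta> / 2 ^ D)" by (rule sum_bounded_above) (rule G_prob)
  finally have G: "prob (\<Union>i\<in>S. G i) \<le> real (card S) * (\<beta> / 2 ^ D)" .
  have "real (card S + 1) \<le> real (2 ^ D)"
    using card_subopt_leaves_less[of D \<mu>] by (intro of_nat_mono) (simp add: S_def)
  then have "(real (card S) + 1) * (\<beta> / 2 ^ D) \<le> 2 ^ D * (\<beta> / 2 ^ D)"
    using \<beta> by (intro mult_right_mono) auto
  with F G have FG: "prob (\<Union>k. F k) + prob (\<Union>i\<in>S. G i) \<le> \<beta>"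
    by (simp add: distrib_right add_divide_distrib)

  define Bad where "Bad = (\<Union>k. F k) \<union> (\<Union>i\<in>S. G i)"
  have G_Un: "(\<Union>i\<in>S. G i) \<in> sets M" 
    using G_sets by (intro sets.finite_UN) (auto simp: S_def)
  have Bad_sets: "Bad \<in> sets M" unfolding Bad_def using F_sets G_Un by auto
  have "prob Bad \<le> \<beta>"
    unfolding Bad_def using FG measure_Un_le[of "\<Union>k. F k" M "\<Union>i\<in>S. G i"] F_sets G_Un by auto
  then have E_prob: "1 - \<beta> \<le> prob (space M - Bad)" using Bad_sets by (simp add: prob_compl)

  have regret: "pseudo_regret D \<mu> (\<lambda>n. I n \<omega>) n
      \<le> 6 * (\<Sum>i\<in>S. 1 / gap D \<mu> i * ln (2 ^ (D + 2) / ((gap D \<mu> i)\<^sup>2 * \<beta>)))"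
    if \<omega>: "\<omega> \<in> space M - Bad" for \<omega> n
  proof -
    from \<omega> have \<omega>_sp: "\<omega> \<in> space M" by simp
    note r = run[OF \<omega>_sp]
    have opt: "v < ?mean j k \<omega> + conf_width D \<beta> k" if "k \<ge> 1" for k
    proof -
      have "\<omega> \<notin> F (k - 1)" using \<omega> by (auto simp: Bad_def)
      moreover have "Suc (k - 1) = k" using that by simp
      ultimately have "\<not> ?mean j k \<omega> \<le> v - conf_width D \<beta> k"
        using \<omega>_sp by (simp only: F_def mem_Collect_eq simp_thms)
      then show ?thesis by linarith
    qed
    have "real (visits (\<lambda>n. I n \<omega>) n i) * gap D \<mu> i
        \<le> 6 * (1 / gap D \<mu> i * ln (2 ^ (D + 2) / ((gap D \<mu> i)\<^sup>2 * \<beta>)))" if i: "i \<in> S" for i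
    proof -
      have "\<omega> \<notin> G i" using \<omega> i by (auto simp: Bad_def)
      then have "?mean i (u i) \<omega> + conf_width D \<beta> (u i) < v" using \<omega>_sp by (auto simp: G_def)
      then have "visits (\<lambda>n. I n \<omega>) n i \<le> u i"
        by (intro visits_le[OF r S(1)[OF i] j(1) threshold(1)[OF i] opt])
      \<comment> \<open>As \<open>u i\<close> is at least 1, \<open>nat\<close> did not truncate a
        negative number.\<close>
      also have "real (u i) \<le> 6 * ln (2 ^ (D + 2) / ((gap D \<mu> i)\<^sup>2 * \<beta>)) / (gap D \<mu> i)\<^sup>2"
        using threshold(1)[OF i] unfolding u_def by linarith
      finally have "real (visits (\<lambda>n. I n \<omega>) n i) * gap D \<mu> i
          \<le> 6 * ln (2 ^ (D + 2) / ((gap D \<mu> i)\<^sup>2 * \<beta>)) / (gap D \<mu> i)\<^sup>2 * gap D \<mu> i"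
        using S(2)[OF i] by (intro mult_right_mono) auto
      then show ?thesis using S(2)[OF i] by (simp add: power2_eq_square)
    qed
    moreover have "pseudo_regret D \<mu> (\<lambda>n. I n \<omega>) n =
        (\<Sum>i\<in>S. real (visits (\<lambda>n. I n \<omega>) n i) * gap D \<mu> i)"
      unfolding S_def
      by (rule pseudo_regret_eq) (use r in \<open>auto simp: tree_search_run_def trajectory_def\<close>)
    ultimately show ?thesis unfolding sum_distrib_left by (simp only: sum_mono)
  qed
  show ?thesis
  proof (intro conjI impI)
    show "\<exists>E \<in> sets M. measure M E \<ge> 1 - \<beta> \<and>
            (\<forall>\<omega>\<in>E. \<forall>n\<ge>1. pseudo_regret D \<mu> (\<lambda>n. I n \<omega>) n
               \<le> 6 * (\<Sum>i\<in>subopt_leaves D \<mu>.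
                        1 / gap D \<mu> i * ln (2 ^ (D + 2) / ((gap D \<mu> i)\<^sup>2 * \<beta>))))"
      using regret E_prob Bad_sets unfolding S_def by (intro bexI[of _ "space M - Bad"]) auto
  qed (rule sum_subopt_leaves_le[OF _ \<beta> gap_le])
qed

end
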